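(* Every derivation of the extended Schrödinger-Virasoro Lie algebra $\widetilde{\mathfrak{sv}}$ is inner: $\mathrm{Der}(\widetilde{\mathfrak{sv}})=\mathrm{Inn}(\widetilde{\mathfrak{sv}})$, i.e. $H^1(\widetilde{\mathfrak{sv}},\widetilde{\mathfrak{sv}})=0$.
   Context: The extended Schrödinger-Virasoro Lie algebra $\widetilde{\mathfrak{sv}}$ is the complex Lie algebra with basis $\{L_n, M_n, N_n, Y_{n+\frac12} \mid n\in\mathbb{Z}\}$ and brackets, for all $m,n\in\mathbb{Z}$: $[L_m,L_n]=(n-m)L_{m+n}$, $[M_m,M_n]=0$, $[N_m,N_n]=0$, $[Y_{m+\frac12},Y_{n+\frac12}]=(m-n)M_{m+n+1}$, $[L_m,M_n]=nM_{m+n}$, $[L_m,N_n]=nN_{m+n}$, $[L_m,Y_{n+\frac12}]=\left(n+\frac{1-m}{2}\right)Y_{m+n+\frac12}$, $[N_m,M_n]=2M_{m+n}$, $[N_m,Y_{n+\frac12}]=Y_{m+n+\frac12}$, $[M_m,Y_{n+\frac12}]=0$. For a Lie algebra $\mathfrak{g}$ and a $\mathfrak{g}$-module $V$, a derivation is a linear map $D:\mathfrak{g}\to V$ with $D[x,y]=x.D(y)-y.D(x)$; it is inner if $D(x)=x.v$ for all $x\in\mathfrak{g}$, for some $v\in V$. $\mathrm{Der}(\mathfrak{g},V)$ and $\mathrm{Inn}(\mathfrak{g},V)$ are the spaces of derivations and inner derivations, and $H^1(\mathfrak{g},V)=\mathrm{Der}(\mathfrak{g},V)/\mathrm{Inn}(\mathfrak{g},V)$.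 For $V=\mathfrak{g}$ the adjoint module, write $\mathrm{Der}(\mathfrak{g})$ and $\mathrm{Inn}(\mathfrak{g})$. *)

theory Defs
  imports Complex_Main "HOL-Library.Poly_Mapping"
begin

section \<open>Lie algebras, modules and first cohomology\<close>

locale lie_algebra = vector_space scale
  for scale :: "'k::field \<Rightarrow> 'g::ab_group_add \<Rightarrow> 'g" +
  fixes bracket :: "'g \<Rightarrow> 'g \<Rightarrow> 'g"
  assumes linear_bracket_left: "Vector_Spaces.linear scale scale (\<lambda>x. bracket x y)"
    and linear_bracket_right: "Vector_Spaces.linear scale scale (\<lambda>y. bracket x y)"
    and bracket_self: "bracket x x = 0"
    and jacobi: "bracket x (bracket y z) + bracket y (bracket z x) + bracket z (bracket x y) = 0"

locale lie_module = lie_algebra scale bracket + mod: vector_space mscale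
  for scale :: "'k::field \<Rightarrow> 'g::ab_group_add \<Rightarrow> 'g"
    and bracket :: "'g \<Rightarrow> 'g \<Rightarrow> 'g"
    and mscale :: "'k \<Rightarrow> 'v::ab_group_add \<Rightarrow> 'v" +
  fixes act :: "'g \<Rightarrow> 'v \<Rightarrow> 'v"
  assumes linear_act_left: "Vector_Spaces.linear scale mscale (\<lambda>x. act x v)"
    and linear_act_right: "Vector_Spaces.linear mscale mscale (\<lambda>v. act x v)"
    and act_bracket: "act (bracket x y) v = act x (act y v) - act y (act x v)"
begin

definition Der :: "('g \<Rightarrow> 'v) set" where
  "Der = {D. Vector_Spaces.linear scale mscale D \<and>
             (\<forall>x y. D (bracket x y) = act x (D y) - act y (D x))}"

definition Inn :: "('g \<Rightarrow> 'v) set" where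
  "Inn = {D. \<exists>v. \<forall>x. D x = act x v}"

definition Inn_coset :: "('g \<Rightarrow> 'v) \<Rightarrow> ('g \<Rightarrow> 'v) set" where
  "Inn_coset D = {\<lambda>x. D x + E x | E. E \<in> Inn}"

text \<open>The underlying set of the quotient space \<open>Der / Inn\<close>; its zero is \<open>Inn_coset (\<lambda>_. 0)\<close>.\<close>

definition H1 :: "('g \<Rightarrow> 'v) set set" where
  "H1 = Inn_coset ` Der"

lemma Inn_subset_Der: "Inn \<subseteq> Der"
proof
  fix D assume "D \<in> Inn"
  then obtain v where "D = (\<lambda>x. act x v)" by (auto simp: Inn_def)
  then show "D \<in> Der"
    using linear_act_left by (simp add: Der_def act_bracket)
qed

lemma Inn_zero: "(\<lambda>_. 0) \<in> Inn"
  using module_hom.zero[OF linear_act_right[unfolded linear_iff_module_hom]]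
  by (auto simp: Inn_def intro: exI[of _ 0])

lemma Inn_add: "D \<in> Inn \<Longrightarrow> E \<in> Inn \<Longrightarrow> (\<lambda>x. D x + E x) \<in> Inn"
  unfolding Inn_def
  using module_hom.add[OF linear_act_right[unfolded linear_iff_module_hom]]
  by (auto, metis)

lemma Inn_diff: "D \<in> Inn \<Longrightarrow> E \<in> Inn \<Longrightarrow> (\<lambda>x. D x - E x) \<in> Inn"
  unfolding Inn_def
  using module_hom.diff[OF linear_act_right[unfolded linear_iff_module_hom]]
  by (auto, metis)

lemma Inn_coset_zero: "Inn_coset (\<lambda>_. 0) = Inn"
  by (simp add: Inn_coset_def)

lemma mem_Inn_coset_iff: "F \<in> Inn_coset D \<longleftrightarrow> (\<lambda>x. F x - D x) \<in> Inn"
proof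
  assume "(\<lambda>x. F x - D x) \<in> Inn"
  then show "F \<in> Inn_coset D"
    by (auto simp: Inn_coset_def intro!: exI[of _ "\<lambda>x. F x - D x"])
qed (auto simp: Inn_coset_def)

lemma Inn_coset_eq_iff: "Inn_coset D = Inn_coset E \<longleftrightarrow> (\<lambda>x. D x - E x) \<in> Inn"
proof
  assume "Inn_coset D = Inn_coset E"
  moreover have "D \<in> Inn_coset D" using Inn_zero by (simp add: mem_Inn_coset_iff)
  ultimately show "(\<lambda>x. D x - E x) \<in> Inn" by (simp add: mem_Inn_coset_iff)
next
  assume DE: "(\<lambda>x. D x - E x) \<in> Inn"
  have "(\<lambda>x. F x - D x) \<in> Inn \<longleftrightarrow> (\<lambda>x. F x - E x) \<in> Inn" for F
    using Inn_add[OF DE, of "\<lambda>x. F x - D x"] Inn_diff[OF _ DE, of "\<lambda>x. F x - E x"]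
    by (auto simp: algebra_simps)
  then show "Inn_coset D = Inn_coset E" by (auto simp: mem_Inn_coset_iff)
qed

end

context lie_algebra
begin

lemma bracket_add_left: "bracket (x + y) z = bracket x z + bracket y z"
  using module_hom.add[OF linear_bracket_left[unfolded linear_iff_module_hom]] .

lemma bracket_add_right: "bracket x (y + z) = bracket x y + bracket x z"
  using module_hom.add[OF linear_bracket_right[unfolded linear_iff_module_hom]] .

lemma bracket_minus_right: "bracket x (- y) = - bracket x y"
  using module_hom.neg[OF linear_bracket_right[unfolded linear_iff_module_hom]] .

lemma bracket_anticommute: "bracket y x = - bracket x y"
proof -
  have "bracket x y + bracket y x = 0"
    using bracket_self[of "x + y"] bracket_self[of x] bracket_self[of y]
    by (simp add: bracket_add_left bracket_add_right add.commute)
  then show ?thesis by (simp add: add_eq_0_iff)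
qed

end

sublocale lie_algebra \<subseteq> adjoint: lie_module scale bracket scale bracket
proof (intro lie_module.intro lie_module_axioms.intro)
  show "bracket (bracket x y) v = bracket x (bracket y v) - bracket y (bracket x v)" for x y v
    using jacobi[of x y v] bracket_anticommute[of "bracket x y" v]
      bracket_anticommute[of x v] bracket_minus_right[of y "bracket x v"]
    by (simp add: algebra_simps)
qed (fact lie_algebra_axioms vector_space_axioms linear_bracket_left linear_bracket_right)+

section \<open>The extended Schroedinger-Virasoro Lie algebra\<close>

text \<open>The index \<open>Y n\<close> stands for the basis element \<open>Y\<^bsub>n+1/2\<^esub>\<close>.\<close>

datatype esv_index = L int | M int | N int | Y int

type_synonym esv = "esv_index \<Rightarrow>\<^sub>0 complex"

abbreviation esv_scale :: "complex \<Rightarrow> esv \<Rightarrow> esv" where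
  "esv_scale c \<equiv> Poly_Mapping.map ((*) c)"

text \<open>The brackets of basis elements. The second half of the equations is determined by
  antisymmetry. In the equation for \<open>Y m\<close>, \<open>Y n\<close> the result has index
  \<open>(m + 1/2) + (n + 1/2) = m + n + 1\<close>.\<close>

fun basis_bracket :: "esv_index \<Rightarrow> esv_index \<Rightarrow> esv" where
  "basis_bracket (L m) (L n) = Poly_Mapping.single (L (m + n)) (of_int (n - m))"
| "basis_bracket (M m) (M n) = 0"
| "basis_bracket (N m) (N n) = 0"
| "basis_bracket (Y m) (Y n) = Poly_Mapping.single (M (m + n + 1)) (of_int (m - n))"
| "basis_bracket (L m) (M n) = Poly_Mapping.single (M (m + n)) (of_int n)"
| "basis_bracket (L m) (N n) = Poly_Mapping.single (N (m + n)) (of_int n)"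
| "basis_bracket (L m) (Y n) = Poly_Mapping.single (Y (m + n)) (of_int n + (1 - of_int m) / 2)"
| "basis_bracket (N m) (M n) = Poly_Mapping.single (M (m + n)) 2"
| "basis_bracket (N m) (Y n) = Poly_Mapping.single (Y (m + n)) 1"
| "basis_bracket (M m) (Y n) = 0"
| "basis_bracket (M n) (L m) = - Poly_Mapping.single (M (m + n)) (of_int n)"
| "basis_bracket (N n) (L m) = - Poly_Mapping.single (N (m + n)) (of_int n)"
| "basis_bracket (Y n) (L m) = - Poly_Mapping.single (Y (m + n)) (of_int n + (1 - of_int m) / 2)"
| "basis_bracket (M n) (N m) = - Poly_Mapping.single (M (m + n)) 2"
| "basis_bracket (Y n) (N m) = - Poly_Mapping.single (Y (m + n)) 1"
| "basis_bracket (Y n) (M m) = 0"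

definition esv_bracket :: "esv \<Rightarrow> esv \<Rightarrow> esv" where
  "esv_bracket x y =
     (\<Sum>a\<in>Poly_Mapping.keys x. \<Sum>b\<in>Poly_Mapping.keys y.
        esv_scale (Poly_Mapping.lookup x a * Poly_Mapping.lookup y b) (basis_bracket a b))"

lemma lookup_esv_scale [simp]:
  "Poly_Mapping.lookup (esv_scale c x) k = c * Poly_Mapping.lookup x k"
  by (transfer, simp add: when_def)

lemma vector_space_esv_scale: "vector_space esv_scale"
  by unfold_locales (auto intro!: poly_mapping_eqI simp: lookup_add algebra_simps)

lemma lookup_esv_bracket:
  assumes "finite A" "finite B" "Poly_Mapping.keys x \<subseteq> A" "Poly_Mapping.keys y \<subseteq> B"
  shows "Poly_Mapping.lookup (esv_bracket x y) k =
    (\<Sum>a\<in>A. \<Sum>b\<in>B. Poly_Mapping.lookup x a * Poly_Mapping.lookup y b *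
        Poly_Mapping.lookup (basis_bracket a b) k)"
proof -
  have "Poly_Mapping.lookup (esv_bracket x y) k =
    (\<Sum>a\<in>Poly_Mapping.keys x. \<Sum>b\<in>Poly_Mapping.keys y.
       Poly_Mapping.lookup x a * Poly_Mapping.lookup y b *
        Poly_Mapping.lookup (basis_bracket a b) k)"
    by (simp add: esv_bracket_def lookup_sum)
  also have "\<dots> = (\<Sum>a\<in>Poly_Mapping.keys x. \<Sum>b\<in>B.
       Poly_Mapping.lookup x a * Poly_Mapping.lookup y b *
        Poly_Mapping.lookup (basis_bracket a b) k)"
    using assms by (intro sum.cong refl sum.mono_neutral_left) (auto simp: in_keys_iff)
  also have "\<dots> = (\<Sum>a\<in>A. \<Sum>b\<in>B.
       Poly_Mapping.lookup x a * Poly_Mapping.lookup y b *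
        Poly_Mapping.lookup (basis_bracket a b) k)"
    using assms by (intro sum.mono_neutral_left) (auto simp: in_keys_iff)
  finally show ?thesis .
qed

lemma esv_bracket_add_left: "esv_bracket (x + x') y = esv_bracket x y + esv_bracket x' y"
proof (rule poly_mapping_eqI)
  fix k
  let ?A = "Poly_Mapping.keys x \<union> Poly_Mapping.keys x'" and ?B = "Poly_Mapping.keys y"
  note l = lookup_esv_bracket[of ?A ?B]
  show "Poly_Mapping.lookup (esv_bracket (x + x') y) k =
      Poly_Mapping.lookup (esv_bracket x y + esv_bracket x' y) k"
    using Poly_Mapping.keys_add[of x x']
    by (simp add: lookup_add l sum.distrib[symmetric] distrib_right)
qed

lemma esv_bracket_add_right: "esv_bracket x (y + y') = esv_bracket x y + esv_bracket x y'"
proof (rule poly_mapping_eqI)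
  fix k
  let ?A = "Poly_Mapping.keys x" and ?B = "Poly_Mapping.keys y \<union> Poly_Mapping.keys y'"
  note l = lookup_esv_bracket[of ?A ?B]
  show "Poly_Mapping.lookup (esv_bracket x (y + y')) k =
      Poly_Mapping.lookup (esv_bracket x y + esv_bracket x y') k"
    using Poly_Mapping.keys_add[of y y']
    by (simp add: lookup_add l sum.distrib[symmetric] distrib_right distrib_left)
qed

lemma keys_esv_scale: "Poly_Mapping.keys (esv_scale c x) \<subseteq> Poly_Mapping.keys x"
  by (auto simp: in_keys_iff)

lemma esv_bracket_scale_left: "esv_bracket (esv_scale c x) y = esv_scale c (esv_bracket x y)"
proof (rule poly_mapping_eqI)
  fix k
  note l = lookup_esv_bracket[of "Poly_Mapping.keys x" "Poly_Mapping.keys y"]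
  show "Poly_Mapping.lookup (esv_bracket (esv_scale c x) y) k =
      Poly_Mapping.lookup (esv_scale c (esv_bracket x y)) k"
    by (simp add: l keys_esv_scale sum_distrib_left mult_ac)
qed

lemma esv_bracket_scale_right: "esv_bracket x (esv_scale c y) = esv_scale c (esv_bracket x y)"
proof (rule poly_mapping_eqI)
  fix k
  note l = lookup_esv_bracket[of "Poly_Mapping.keys x" "Poly_Mapping.keys y"]
  show "Poly_Mapping.lookup (esv_bracket x (esv_scale c y)) k =
      Poly_Mapping.lookup (esv_scale c (esv_bracket x y)) k"
    by (simp add: l keys_esv_scale sum_distrib_left mult_ac)
qed

lemma esv_bracket_single:
  "esv_bracket (Poly_Mapping.single a c) (Poly_Mapping.single b d) =
     esv_scale (c * d) (basis_bracket a b)"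
  by (rule poly_mapping_eqI, subst lookup_esv_bracket[of "{a}" "{b}"]) auto

lemma esv_bracket_zero [simp]: "esv_bracket 0 x = 0" "esv_bracket x 0 = 0"
  by (simp_all add: esv_bracket_def)

lemma esv_bracket_minus_right: "esv_bracket x (- y) = - esv_bracket x y"
  using esv_bracket_add_right[of x y "- y"] by (simp add: eq_neg_iff_add_eq_0 add.commute)

lemma esv_induct [case_names zero single add]:
  fixes x :: esv
  assumes "P 0" "\<And>a c. P (Poly_Mapping.single a c)" "\<And>x y. P x \<Longrightarrow> P y \<Longrightarrow> P (x + y)"
  shows "P x"
proof -
  have "P (\<Sum>a\<in>A. Poly_Mapping.single a (Poly_Mapping.lookup x a))" if "finite A" for A
    using that by (induction A) (auto intro: assms)
  moreover have "x = (\<Sum>a\<in>Poly_Mapping.keys x. Poly_Mapping.single a (Poly_Mapping.lookup x a))"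
    by (rule poly_mapping_eqI) (simp add: lookup_sum lookup_single when_def in_keys_iff)
  ultimately show ?thesis by (metis finite_keys)
qed

lemma basis_bracket_anticommute: "basis_bracket b a = - basis_bracket a b"
  by (cases a; cases b)
     (simp_all add: single_uminus[symmetric] add_ac del: single_uminus)

lemma esv_scale_uminus: "esv_scale c (- x) = - esv_scale c x"
  by (rule poly_mapping_eqI) simp

lemma esv_bracket_anticommute: "esv_bracket y x = - esv_bracket x y"
proof (induction x rule: esv_induct)
  case (single a c)
  show ?case
  proof (induction y rule: esv_induct)
    case (single b d)
    show ?case
      by (simp add: esv_bracket_single basis_bracket_anticommute[of b a] esv_scale_uminus mult.commute)
  qed (simp_all add: esv_bracket_add_left esv_bracket_add_right)
qed (simp_all add: esv_bracket_add_left esv_bracket_add_right)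

lemma esv_scale_single: "esv_scale c (Poly_Mapping.single a d) = Poly_Mapping.single a (c * d)"
  by (rule poly_mapping_eqI) (simp add: lookup_single when_def)

lemma esv_scale_zero: "esv_scale c 0 = 0"
  by (rule poly_mapping_eqI) simp

lemma esv_jacobi:
  "esv_bracket x (esv_bracket y z) + esv_bracket y (esv_bracket z x)
    + esv_bracket z (esv_bracket x y) = 0" (is "?J x y z = 0")
proof -
  have basis: "?J (Poly_Mapping.single a p) (Poly_Mapping.single b q) (Poly_Mapping.single c r) = 0"
    for a b c p q r
    by (cases a; cases b; cases c)
       (simp_all add: esv_bracket_single esv_scale_single esv_scale_zero esv_scale_uminus esv_bracket_minus_right
          add_ac single_add[symmetric] single_diff[symmetric] single_uminus[symmetric],
        (simp_all add: field_simps)?)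
  have 1: "?J (Poly_Mapping.single a p) (Poly_Mapping.single b q) z = 0" for a b p q
  proof (induction z rule: esv_induct)
    case (add z z')
    have "?J u v (z + z') = ?J u v z + ?J u v z'" for u v by (simp add: esv_bracket_add_left esv_bracket_add_right)
    then show ?case using add by simp
  qed (simp_all add: basis)
  have 2: "?J (Poly_Mapping.single a p) y z = 0" for a p
  proof (induction y rule: esv_induct)
    case (add y y')
    have "?J u (y + y') z = ?J u y z + ?J u y' z" for u by (simp add: esv_bracket_add_left esv_bracket_add_right)
    then show ?case using add by simp
  qed (simp_all add: 1)
  show ?thesis
  proof (induction x rule: esv_induct)
    case (add x x')
    have "?J (x + x') y z = ?J x y z + ?J x' y z" by (simp add: esv_bracket_add_left esv_bracket_add_right)
    then show ?case using add by simp
  qed (simp_all add: 2)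
qed

global_interpretation esv: lie_algebra esv_scale esv_bracket
proof -
  interpret vector_space esv_scale by (rule vector_space_esv_scale)
  show "lie_algebra esv_scale esv_bracket"
  proof
    show "esv_bracket x x = 0" for x
    proof (rule poly_mapping_eqI)
      fix k
      show "Poly_Mapping.lookup (esv_bracket x x) k = Poly_Mapping.lookup 0 k"
        using arg_cong[OF esv_bracket_anticommute[of x x], of "\<lambda>u. Poly_Mapping.lookup u k"] by simp
    qed
  qed (simp_all add: esv_bracket_add_left esv_bracket_add_right
        esv_bracket_scale_left esv_bracket_scale_right esv_jacobi)
qed

end

theory Submission
  imports Defs
begin

text \<open>The elements \<open>L\<^sub>0\<close> and \<open>N\<^sub>0\<close> act diagonally on the basis, so a derivation \<open>D\<close> can be corrected
  by an inner one until \<open>D L\<^sub>0\<close> has weight \<open>0\<close>; comparing weights in \<open>D [L\<^sub>0, x]\<close> then shows that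
  \<open>D L\<^sub>0\<close> is central, hence zero, and likewise for \<open>N\<^sub>0\<close>. A derivation killing both preserves the
  joint weight spaces \<open>\<langle>L\<^sub>n, N\<^sub>n\<rangle>\<close>, \<open>\<langle>M\<^sub>n\<rangle>\<close>, \<open>\<langle>Y\<^bsub>n+1/2\<^esub>\<rangle>\<close>, and its matrix entries satisfy functional
  equations whose only solutions come from a combination of \<open>L\<^sub>0\<close> and \<open>N\<^sub>0\<close>.\<close>

section \<open>Weights with respect to \<open>L 0\<close> and \<open>N 0\<close>\<close>

abbreviation esv_basis :: "esv_index \<Rightarrow> esv" where
  "esv_basis a \<equiv> Poly_Mapping.single a 1"

fun L0_weight :: "esv_index \<Rightarrow> complex" where
  "L0_weight (L n) = of_int n"
| "L0_weight (M n) = of_int n"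
| "L0_weight (N n) = of_int n"
| "L0_weight (Y n) = of_int n + 1 / 2"

fun N0_weight :: "esv_index \<Rightarrow> complex" where
  "N0_weight (L n) = 0"
| "N0_weight (M n) = 2"
| "N0_weight (N n) = 0"
| "N0_weight (Y n) = 1"

text \<open>Stated on the coefficients of an arbitrary \<open>v\<close>, so that comparing weights
  means comparing coefficients at a single index.\<close>

definition eigenvalues_of :: "esv \<Rightarrow> (esv_index \<Rightarrow> complex) \<Rightarrow> bool" where
  "eigenvalues_of h w \<longleftrightarrow>
     (\<forall>v k. Poly_Mapping.lookup (esv_bracket h v) k = w k * Poly_Mapping.lookup v k)"

lemma eigenvalues_ofI:
  assumes "\<And>a c. esv_bracket h (Poly_Mapping.single a c) = Poly_Mapping.single a (w a * c)"
  shows "eigenvalues_of h w"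
  unfolding eigenvalues_of_def
proof (intro allI)
  fix v k
  show "Poly_Mapping.lookup (esv_bracket h v) k = w k * Poly_Mapping.lookup v k"
    by (induction v rule: esv_induct)
       (simp_all add: assms esv_bracket_add_right lookup_add lookup_single when_def distrib_left)
qed

lemma eigenvalues_of_L0: "eigenvalues_of (esv_basis (L 0)) L0_weight"
proof (rule eigenvalues_ofI)
  fix a c
  show "esv_bracket (esv_basis (L 0)) (Poly_Mapping.single a c) =
      Poly_Mapping.single a (L0_weight a * c)"
    by (cases a) (simp_all add: esv_bracket_single esv_scale_single mult.commute)
qed

lemma eigenvalues_of_N0: "eigenvalues_of (esv_basis (N 0)) N0_weight"
proof (rule eigenvalues_ofI)
  fix a c
  show "esv_bracket (esv_basis (N 0)) (Poly_Mapping.single a c) =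
      Poly_Mapping.single a (N0_weight a * c)"
    by (cases a)
       (simp_all add: esv_bracket_single esv_scale_single esv_scale_zero esv_scale_uminus mult.commute)
qed

lemma esv_basis_bracket:
  "esv_bracket (esv_basis a) (esv_basis b) = basis_bracket a b"
  by (rule poly_mapping_eqI) (simp add: esv_bracket_single)

text \<open>By the Jacobi identity \<open>h\<close> acts as a derivation of the bracket, so
  eigenvalues add.\<close>

lemma eigenvalues_of_bracket:
  assumes "eigenvalues_of h w" "esv_bracket h x = esv_scale c x" "esv_bracket h y = esv_scale d y"
  shows "esv_bracket h (esv_bracket x y) = esv_scale (c + d) (esv_bracket x y)"
proof -
  have "esv_bracket h (esv_bracket x y) =
      esv_bracket (esv_bracket h x) y + esv_bracket x (esv_bracket h y)"
    using esv.adjoint.act_bracket[of h x y] by (simp add: algebra_simps)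
  also have "\<dots> = esv_scale (c + d) (esv_bracket x y)"
    by (rule poly_mapping_eqI)
       (simp add: assms esv_bracket_scale_left esv_bracket_scale_right lookup_add distrib_right)
  finally show ?thesis .
qed

lemma eigenvalues_of_basis:
  assumes "eigenvalues_of h w"
  shows "esv_bracket h (esv_basis a) = esv_scale (w a) (esv_basis a)"
  using assms by (intro poly_mapping_eqI) (simp add: eigenvalues_of_def lookup_single when_def)

section \<open>Derivations, inner corrections and values on the basis\<close>

lemma Der_iff:
  "D \<in> esv.adjoint.Der \<longleftrightarrow>
     (\<forall>x y. D (x + y) = D x + D y) \<and> (\<forall>c x. D (esv_scale c x) = esv_scale c (D x)) \<and>
     (\<forall>x y. D (esv_bracket x y) = esv_bracket x (D y) - esv_bracket y (D x))"
  unfolding esv.adjoint.Der_def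
  using vector_space_esv_scale
  by (auto simp: Vector_Spaces.linear_def module_hom_def module_hom_axioms_def vector_space_def module_def)

lemma esv_bracket_diff_right: "esv_bracket x (y - z) = esv_bracket x y - esv_bracket x z"
  using esv_bracket_add_right[of x y "- z"] by (simp add: esv_bracket_minus_right)

lemma Der_diff_inner:
  assumes "D \<in> esv.adjoint.Der"
  shows "(\<lambda>x. D x - esv_bracket x v) \<in> esv.adjoint.Der"
proof -
  have "(\<lambda>x. esv_bracket x v) \<in> esv.adjoint.Der"
    using esv.adjoint.Inn_subset_Der by (auto simp: esv.adjoint.Inn_def)
  with assms show ?thesis
    by (simp add: Der_iff esv.scale_right_diff_distrib esv_bracket_diff_right)
qed

lemma Der_single:
  assumes "D \<in> esv.adjoint.Der"
  shows "D (Poly_Mapping.single a c) = esv_scale c (D (esv_basis a))"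
proof -
  have "Poly_Mapping.single a c = esv_scale c (esv_basis a)"
    by (simp add: esv_scale_single)
  then show ?thesis using assms by (metis Der_iff)
qed

lemma Der_basis_bracket:
  assumes "D \<in> esv.adjoint.Der"
  shows "D (basis_bracket a b) =
    esv_bracket (esv_basis a) (D (esv_basis b)) - esv_bracket (esv_basis b) (D (esv_basis a))"
  using assms by (metis Der_iff esv_basis_bracket)

lemma Der_eqI:
  assumes D: "D \<in> esv.adjoint.Der" and E: "E \<in> esv.adjoint.Der"
    and eq: "\<And>a. D (esv_basis a) = E (esv_basis a)"
  shows "D x = E x"
proof (induction x rule: esv_induct)
  case zero
  \<comment> \<open>The index is arbitrary: a single entry with coefficient 0 is the zero vector at
    any index.\<close>
  show ?case using Der_single[OF D, of undefined 0] Der_single[OF E, of undefined 0] eq by simp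
next
  case (single a c)
  show ?case by (metis Der_single D E eq)
next
  case (add x y)
  then show ?case using D E by (simp add: Der_iff)
qed

section \<open>The trivial center and the comparison of weights\<close>

lemma esv_center_trivial:
  assumes "\<And>a. esv_bracket z (esv_basis a) = 0"
  shows "z = 0"
proof -
  have flip: "esv_bracket (esv_basis a) z = 0" for a
    using assms[of a] esv_bracket_anticommute[of "esv_basis a" z] by simp
  have w: "w k * Poly_Mapping.lookup z k = 0" if "eigenvalues_of (esv_basis h) w" for h w k
    using that flip[of h] by (metis eigenvalues_of_def lookup_zero)
  define a c where "a = Poly_Mapping.lookup z (L 0)" and "c = Poly_Mapping.lookup z (N 0)"
  \<comment> \<open>Commuting with \<open>L 0\<close> and \<open>N 0\<close> kills every coefficient
    except those where both weights are 0, that is at \<open>L 0\<close> and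
    \<open>N 0\<close>.\<close>
  have z: "z = Poly_Mapping.single (L 0) a + Poly_Mapping.single (N 0) c"
  proof (rule poly_mapping_eqI)
    fix k
    show "Poly_Mapping.lookup z k =
        Poly_Mapping.lookup (Poly_Mapping.single (L 0) a + Poly_Mapping.single (N 0) c) k"
      using w[OF eigenvalues_of_L0, of k] w[OF eigenvalues_of_N0, of k]
      by (cases k) (auto simp: lookup_add lookup_single when_def a_def c_def)
  qed
  \<comment> \<open>This is the eigenvalue of \<open>z\<close> on \<open>M i\<close>; the values at
    \<open>i = 0\<close> and \<open>i = 1\<close> determine \<open>c\<close> and then
    \<open>a\<close>.\<close>
  have "n * a + 2 * c = 0" if "n = of_int i" for n i
    using arg_cong[OF assms[of "M i"], of "\<lambda>v. Poly_Mapping.lookup v (M i)"] that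
    by (simp add: z esv_bracket_add_left esv_bracket_single lookup_add mult.commute)
  from this[of 0 0] this[of 1 1] have "a = 0" "c = 0" by auto
  then show ?thesis by (simp add: z)
qed

text \<open>Since \<open>D h = 0\<close>, the map \<open>D\<close> commutes with the action of
  \<open>h\<close> and so preserves its eigenspaces.\<close>

lemma Der_diagonal_weight:
  assumes D: "D \<in> esv.adjoint.Der" and h: "eigenvalues_of h w" and "D h = 0"
    and "w j \<noteq> w k"
  shows "Poly_Mapping.lookup (D (esv_basis k)) j = 0"
proof -
  have "esv_scale (w k) (D (esv_basis k)) = esv_bracket h (D (esv_basis k))"
    using D assms(3) eigenvalues_of_basis[OF h, of k] by (metis Der_iff diff_zero esv_bracket_zero(2))
  then have "w k * Poly_Mapping.lookup (D (esv_basis k)) j = w j * Poly_Mapping.lookup (D (esv_basis k)) j"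
    using h by (metis eigenvalues_of_def lookup_esv_scale)
  with assms(4) show ?thesis by simp
qed

text \<open>After the correction, \<open>h\<close> annihilates \<open>E h\<close>, so the bracket of
  \<open>E h\<close> with a basis vector of weight \<open>w a\<close> again has weight
  \<open>w a\<close>. By the derivation rule that bracket is also the image under
  \<open>w a - h\<close> of a vector, which has no component of weight \<open>w a\<close>. Hence
  \<open>E h\<close> is central. The bound on the keys of \<open>u\<close> ensures later that a
  second correction does not disturb the first.\<close>

lemma Der_diagonal_normalize:
  assumes D: "D \<in> esv.adjoint.Der" and h: "eigenvalues_of h w"
  obtains u where "D h = esv_bracket h u" "Poly_Mapping.keys u \<subseteq> Poly_Mapping.keys (D h)"
proof -
  \<comment> \<open>Inverts \<open>h\<close> on the nonzero weights; at weight 0 the convention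
    \<open>x / 0 = 0\<close> drops the term.\<close>
  define u where "u = (\<Sum>k\<in>Poly_Mapping.keys (D h).
    Poly_Mapping.single k (Poly_Mapping.lookup (D h) k / w k))"
  have u: "Poly_Mapping.lookup u k = Poly_Mapping.lookup (D h) k / w k" for k
    by (simp add: u_def lookup_sum lookup_single when_def in_keys_iff)
  define E where "E = (\<lambda>x. D x - esv_bracket x u)"
  have E: "E \<in> esv.adjoint.Der" unfolding E_def by (rule Der_diff_inner[OF D])
  have "esv_bracket h (E h) = 0"
    using h by (intro poly_mapping_eqI) (simp add: eigenvalues_of_def E_def lookup_minus u)
  then have Eh: "esv_bracket h (E h) = esv_scale 0 (E h)"
    by (intro poly_mapping_eqI) simp
  have "esv_bracket (E h) (esv_basis a) = 0" for a
  proof (rule poly_mapping_eqI)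
    fix j
    let ?z = "esv_bracket (E h) (esv_basis a)"
    have "esv_bracket h ?z = esv_scale (0 + w a) ?z"
      by (rule eigenvalues_of_bracket[OF h Eh eigenvalues_of_basis[OF h]])
    then have z: "w j * Poly_Mapping.lookup ?z j = w a * Poly_Mapping.lookup ?z j"
      using h by (metis eigenvalues_of_def lookup_esv_scale add_0)
    have "esv_scale (w a) (E (esv_basis a)) = E (esv_bracket h (esv_basis a))"
      using E by (simp only: eigenvalues_of_basis[OF h] Der_iff)
    also have "\<dots> = esv_bracket h (E (esv_basis a)) + ?z"
      using E esv_bracket_anticommute[of "E h" "esv_basis a"] by (simp add: Der_iff)
    finally have "w a * Poly_Mapping.lookup (E (esv_basis a)) j =
        w j * Poly_Mapping.lookup (E (esv_basis a)) j + Poly_Mapping.lookup ?z j"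
      using h by (metis eigenvalues_of_def lookup_esv_scale lookup_add)
    with z show "Poly_Mapping.lookup ?z j = Poly_Mapping.lookup 0 j"
      by (cases "w j = w a") auto
  qed
  then have "E h = 0" by (rule esv_center_trivial)
  show thesis
  proof
    show "D h = esv_bracket h u" using \<open>E h = 0\<close> by (simp add: E_def)
    show "Poly_Mapping.keys u \<subseteq> Poly_Mapping.keys (D h)" by (auto simp: in_keys_iff u)
  qed
qed

section \<open>Functional equations for the matrix entries\<close>

lemma Der_zero_on_Cartan:
  assumes D: "D \<in> esv.adjoint.Der"
    and L0: "D (esv_basis (L 0)) = 0" and N0: "D (esv_basis (N 0)) = 0"
  shows "D \<in> esv.adjoint.Inn"
proof -
  let ?c = "\<lambda>k j. Poly_Mapping.lookup (D (esv_basis k)) j"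
  \<comment> \<open>Distinct indices share both weights only in the pairs \<open>L n\<close>,
    \<open>N n\<close>; all other off-diagonal entries vanish.\<close>
  have c: "?c k j = 0" if "L0_weight j \<noteq> L0_weight k \<or> N0_weight j \<noteq> N0_weight k" for k j
    using that Der_diagonal_weight[OF D eigenvalues_of_L0 L0]
      Der_diagonal_weight[OF D eigenvalues_of_N0 N0] by blast
  define a b p q d y where "a n = ?c (L n) (L n)" and "b n = ?c (L n) (N n)"
    and "p n = ?c (N n) (L n)" and "q n = ?c (N n) (N n)"
    and "d n = ?c (M n) (M n)" and "y n = ?c (Y n) (Y n)" for n
  have DL: "D (esv_basis (L n)) = Poly_Mapping.single (L n) (a n) + Poly_Mapping.single (N n) (b n)" for n
  proof (rule poly_mapping_eqI)
    show "?c (L n) k = Poly_Mapping.lookup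
        (Poly_Mapping.single (L n) (a n) + Poly_Mapping.single (N n) (b n)) k" for k
      using c[of k "L n"] by (cases k) (auto simp: lookup_add lookup_single when_def a_def b_def)
  qed
  have DN: "D (esv_basis (N n)) = Poly_Mapping.single (L n) (p n) + Poly_Mapping.single (N n) (q n)" for n
  proof (rule poly_mapping_eqI)
    show "?c (N n) k = Poly_Mapping.lookup
        (Poly_Mapping.single (L n) (p n) + Poly_Mapping.single (N n) (q n)) k" for k
      using c[of k "N n"] by (cases k) (auto simp: lookup_add lookup_single when_def p_def q_def)
  qed
  have DM: "D (esv_basis (M n)) = Poly_Mapping.single (M n) (d n)" for n
  proof (rule poly_mapping_eqI)
    show "?c (M n) k = Poly_Mapping.lookup (Poly_Mapping.single (M n) (d n)) k" for k
      using c[of k "M n"] by (cases k) (auto simp: lookup_single when_def d_def)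
  qed
  have DY: "D (esv_basis (Y n)) = Poly_Mapping.single (Y n) (y n)" for n
  proof (rule poly_mapping_eqI)
    show "?c (Y n) k = Poly_Mapping.lookup (Poly_Mapping.single (Y n) (y n)) k" for k
      using c[of k "Y n"] by (cases k) (auto simp: lookup_single when_def y_def)
  qed
  note D_basis = DL DN DM DY
  have D_scaled: "D (Poly_Mapping.single (L n) s) = esv_scale s (D (esv_basis (L n)))"
    "D (Poly_Mapping.single (M n) s) = esv_scale s (D (esv_basis (M n)))"
    "D (Poly_Mapping.single (N n) s) = esv_scale s (D (esv_basis (N n)))"
    "D (Poly_Mapping.single (Y n) s) = esv_scale s (D (esv_basis (Y n)))" for n s
    by (rule Der_single[OF D])+
  note bracket_simps = D_scaled[unfolded D_basis] esv_bracket_add_right esv_bracket_single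
    esv_scale_single esv_scale_zero esv_scale_uminus lookup_add lookup_minus lookup_single when_def
  have eq: "Poly_Mapping.lookup (D (basis_bracket i j)) k =
      Poly_Mapping.lookup (esv_bracket (esv_basis i) (D (esv_basis j))
        - esv_bracket (esv_basis j) (D (esv_basis i))) k" for i j k
    by (simp only: Der_basis_bracket[OF D])
  have LM: "of_int n * d (m + n) = a m * of_int n + 2 * b m + of_int n * d n" for m n
    using eq[of "L m" "M n" "M (m + n)"] by (simp add: bracket_simps algebra_simps)
  have NM: "2 * d m = 2 * (q m + d 0)" for m
    using eq[of "N m" "M 0" "M m"] by (simp add: bracket_simps algebra_simps)
  have LN_L: "of_int n * p (m + n) = p n * of_int (n - m)" for m n
    using eq[of "L m" "N n" "L (m + n)"] by (simp add: bracket_simps algebra_simps)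
  have LN_N: "of_int n * q (m + n) = of_int n * (a m + q n)" for m n
    using eq[of "L m" "N n" "N (m + n)"] by (simp add: bracket_simps algebra_simps)
  have LL: "of_int (n - m) * a (m + n) = of_int (n - m) * (a m + a n)" for m n
    using eq[of "L m" "L n" "L (m + n)"] by (simp add: bracket_simps algebra_simps)
  have YY: "of_int (m - n) * d (m + n + 1) = of_int (m - n) * (y m + y n)" for m n
    using eq[of "Y m" "Y n" "M (m + n + 1)"] by (simp add: bracket_simps algebra_simps)
  have a0: "a 0 = 0" and q0: "q 0 = 0" and p0: "p 0 = 0"
    using L0 N0 by (simp_all add: a_def p_def q_def)
  \<comment> \<open>\<open>L m\<close> and \<open>M 0\<close> commute, which leaves only the action
    of \<open>b m\<close> times \<open>N m\<close> on \<open>M 0\<close>.\<close>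
  have b: "b m = 0" for m using LM[of 0 m] by simp
  \<comment> \<open>Here and in the next two facts, opposite indices reduce the equation to the
    known values at 0.\<close>
  have p: "p n = 0" for n
    using LN_L[of n "-n"] p0 by (cases "n = 0") auto
  have a_uminus: "a (- n) = - a n" for n
    using LL[of n "-n"] a0 by (cases "n = 0") (auto simp: add_eq_0_iff)
  have q: "q n = a n" for n
    using LN_N[of n "-n"] a0 q0 a_uminus[of n] by (cases "n = 0") (auto simp: add_eq_0_iff)
  \<comment> \<open>\<open>LL\<close> is vacuous for \<open>m = n\<close>. With
    \<open>q = a\<close>, \<open>LN_N\<close> leaves out only \<open>n = 0\<close>, which
    \<open>a0\<close> covers.\<close>
  have a_add: "a (m + n) = a m + a n" for m n
    using LN_N[of n m] a0 by (cases "n = 0") (auto simp: q)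
  have a: "a n = of_int n * a 1" for n
  proof (induction n rule: int_induct[of _ 0])
    case (step1 i) then show ?case using a_add[of i 1] by (simp add: algebra_simps)
  next
    case (step2 i) then show ?case using a_add[of i "-1"] a_uminus[of 1] by (simp add: algebra_simps)
  qed (simp add: a0)
  have d: "d n = of_int n * a 1 + d 0" for n
    using NM[of n, unfolded mult_cancel_left] a[of n] by (simp add: q)
  \<comment> \<open>The deviation of \<open>y n\<close> from its expected value, \<open>a 1\<close>
    times the \<open>L 0\<close> weight plus \<open>d 0 / 2\<close> times the \<open>N 0\<close>
    weight.\<close>
  define z where "z n = y n - (of_int n + 1 / 2) * a 1 - d 0 / 2" for n
  have z_add: "z m + z n = 0" if "m \<noteq> n" for m n
  proof -
    have "y m + y n = d (m + n + 1)" using YY[of m n] that by simp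
    also have "\<dots> = of_int (m + n + 1) * a 1 + d 0" by (rule d)
    finally show ?thesis by (simp add: z_def algebra_simps)
  qed
  have "z n = 0" for n
  proof -
    \<comment> \<open>\<open>z_add\<close> requires distinct indices, so three of them are used to
      isolate \<open>z n\<close>.\<close>
    have "2 * z n = (z n + z (n + 1)) + (z n + z (n + 2)) - (z (n + 1) + z (n + 2))"
      by simp
    also have "\<dots> = 0" using z_add by simp
    finally show ?thesis by simp
  qed
  then have y: "y n = (of_int n + 1 / 2) * a 1 + d 0 / 2" for n
    by (simp add: z_def algebra_simps)
  \<comment> \<open>The signs are negative because \<open>v\<close> is the right argument of the
    bracket; \<open>d 0\<close> is halved because \<open>N 0\<close> acts on \<open>M 0\<close> by
    2.\<close>
  define v where "v = Poly_Mapping.single (L 0) (- a 1) + Poly_Mapping.single (N 0) (- d 0 / 2)"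
  have "D x = esv_bracket x v" for x
  proof (rule Der_eqI[OF D])
    show "(\<lambda>x. esv_bracket x v) \<in> esv.adjoint.Der"
      using esv.adjoint.Inn_subset_Der by (auto simp: esv.adjoint.Inn_def)
    show "D (esv_basis k) = esv_bracket (esv_basis k) v" for k
    proof (cases k)
      case (L n)
      then show ?thesis
        by (simp add: v_def D_basis a[of n] b esv_bracket_add_right esv_bracket_single esv_scale_single
            esv_scale_uminus mult_ac flip: single_uminus)
    next
      case (M n)
      then show ?thesis
        by (simp add: v_def D_basis d[of n] esv_bracket_add_right esv_bracket_single esv_scale_single
            esv_scale_uminus mult_ac flip: single_uminus single_add single_diff)
    next
      case (N n)
      then show ?thesis
        by (simp add: v_def D_basis p q a[of n] esv_bracket_add_right esv_bracket_single esv_scale_single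
            esv_scale_uminus esv_scale_zero mult_ac flip: single_uminus)
    next
      case (Y n)
      then show ?thesis
        by (simp add: v_def D_basis y[of n] esv_bracket_add_right esv_bracket_single esv_scale_single
            esv_scale_uminus mult_ac
            right_diff_distrib distrib_left flip: single_uminus single_add single_diff)
    qed
  qed
  then show ?thesis by (auto simp: esv.adjoint.Inn_def)
qed

text \<open>The corrections are made in succession, first at \<open>L 0\<close> and then at
  \<open>N 0\<close>; the second must preserve the vanishing at \<open>L 0\<close>.\<close>

lemma Der_subset_Inn: "esv.adjoint.Der \<subseteq> esv.adjoint.Inn"
proof
  fix D assume D: "D \<in> esv.adjoint.Der"
  obtain u where u: "D (esv_basis (L 0)) = esv_bracket (esv_basis (L 0)) u"
    using Der_diagonal_normalize[OF D eigenvalues_of_L0] .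
  define E where "E = (\<lambda>x. D x - esv_bracket x u)"
  have E: "E \<in> esv.adjoint.Der" unfolding E_def by (rule Der_diff_inner[OF D])
  have EL: "E (esv_basis (L 0)) = 0" by (simp add: E_def u)
  obtain v where v: "E (esv_basis (N 0)) = esv_bracket (esv_basis (N 0)) v"
    and keys_v: "Poly_Mapping.keys v \<subseteq> Poly_Mapping.keys (E (esv_basis (N 0)))"
    using Der_diagonal_normalize[OF E eigenvalues_of_N0] .
  \<comment> \<open>As \<open>E\<close> kills \<open>L 0\<close>, the image of \<open>N 0\<close>
    under \<open>E\<close> has \<open>L 0\<close> weight 0. By \<open>keys_v\<close> so does
    \<open>v\<close>, which therefore commutes with \<open>L 0\<close>.\<close>
  have Lv: "esv_bracket (esv_basis (L 0)) v = 0"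
  proof (rule poly_mapping_eqI)
    fix k
    have "Poly_Mapping.lookup v k = 0" if "L0_weight k \<noteq> 0"
      using that keys_v Der_diagonal_weight[OF E eigenvalues_of_L0 EL, of k "N 0"]
      by (auto simp: in_keys_iff)
    then show "Poly_Mapping.lookup (esv_bracket (esv_basis (L 0)) v) k = Poly_Mapping.lookup 0 k"
      using eigenvalues_of_L0 by (auto simp: eigenvalues_of_def)
  qed
  have inner: "(\<lambda>x. esv_bracket x w) \<in> esv.adjoint.Inn" for w
    by (auto simp: esv.adjoint.Inn_def)
  have "(\<lambda>x. E x - esv_bracket x v) \<in> esv.adjoint.Inn"
    by (rule Der_zero_on_Cartan) (simp_all add: Der_diff_inner[OF E] EL Lv v)
  from esv.adjoint.Inn_add[OF esv.adjoint.Inn_add[OF this inner[of v]] inner[of u]]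
  show "D \<in> esv.adjoint.Inn" by (simp add: E_def)
qed

theorem theorem2p9:
  shows "esv.adjoint.Der = esv.adjoint.Inn \<and>
         esv.adjoint.H1 = {esv.adjoint.Inn_coset (\<lambda>_. 0)}"
proof
  show eq: "esv.adjoint.Der = esv.adjoint.Inn"
    using Der_subset_Inn esv.adjoint.Inn_subset_Der by blast
  have "esv.adjoint.Inn_coset D = esv.adjoint.Inn_coset (\<lambda>_. 0)" if "D \<in> esv.adjoint.Inn" for D
    using that by (simp add: esv.adjoint.Inn_coset_eq_iff)
  then show "esv.adjoint.H1 = {esv.adjoint.Inn_coset (\<lambda>_. 0)}"
    using esv.adjoint.Inn_zero unfolding esv.adjoint.H1_def eq by blast
qed

end
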